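(* Let $q=2^n$, let $k\ge3$ be odd with $\gcd(k,n)=1$, let $d=2^k+1$, and let $f(x)=x^d+g(x)$ with $g\in\mathbb{F}_q[x]$ of degree exactly $2^{k-1}+2$. If there is no $a\in\mathbb{F}_q^*$ such that $g(x)-a x^{2^{k-1}+2}-a^2x^3$ is of the form $c+\sum_{i=0}^{k-1}c_ix^{2^i}$ with $c,c_i\in\mathbb{F}_q$, then $\phi$ is absolutely irreducible. If there is such an $a$, then either $\phi$ is absolutely irreducible, or $\phi$ is a product of two absolutely irreducible factors, both defined over $\mathbb{F}_q$.
   Context: For $f\in\mathbb{F}_q[x]$ let $\phi(x,y,z)=\dfrac{f(x)+f(y)+f(z)+f(x+y+z)}{(x+y)(x+z)(y+z)}\in\mathbb{F}_q[x,y,z]$. (Terms $x^0$ and $x^{2^i}$ of $f$ contribute nothing to $\phi$.) Absolutely irreducible means irreducible over $\overline{\mathbb{F}_q}$. *)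

theory Defs
  imports "HOL-Algebra.Algebraic_Closure_Type" "HOL-Library.Cardinality"
begin

text \<open>Trivariate polynomials over a field 'a are modelled as nested univariate
  polynomials 'a poly poly poly: the innermost variable is x, the middle one y,
  the outermost one z.\<close>

definition var_x :: "'a::comm_ring_1 poly poly poly" where
  "var_x = [:[:[:0, 1:]:]:]"

definition var_y :: "'a::comm_ring_1 poly poly poly" where
  "var_y = [:[:0, 1:]:]"

definition var_z :: "'a::comm_ring_1 poly poly poly" where
  "var_z = [:0, 1:]"

definition subst3 :: "'a::comm_ring_1 poly \<Rightarrow> 'a poly poly poly \<Rightarrow> 'a poly poly poly" where
  "subst3 f P = poly (map_poly (\<lambda>c. [:[:[:c:]:]:]) f) P"

definition phi :: "'a::field poly \<Rightarrow> 'a poly poly poly" where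
  "phi f = (subst3 f var_x + subst3 f var_y + subst3 f var_z
              + subst3 f (var_x + var_y + var_z))
           div ((var_x + var_y) * (var_x + var_z) * (var_y + var_z))"

definition abs_irreducible :: "'a::field poly poly poly \<Rightarrow> bool" where
  "abs_irreducible p = irreducible (map_poly (map_poly (map_poly to_ac)) p)"

end

theory Submission
  imports Defs
begin

text \<open>Modulo terms that do not contribute, phi is a sum of forms, one for each monomial of f. The top form,
  of degree 2e = 2^k - 2, is the product of the lines x + b y + (1 + b) z over b in GF(2^k) other than
  0, 1, and the next nonzero form has degree e and vanishes on none of these lines because k is odd. If phi = P Q
  is a nontrivial factorization, comparing homogeneous components from the top down and using that the
  top forms of P and Q share no line, all components of P and Q in the first e - 1 degrees below the
  top vanish, and both degrees are e. Hence, after scaling, P = A + a and Q = B + a, where A B is the top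
  form and A + B is the next form divided by its coefficient a. Then phi has a constant term a^2 and no other
  components, which is the exceptional shape of g. Frobenius fixes or swaps the factors A and B; as
  its k-th power fixes every line and k is odd, it fixes them, so P and Q are defined over the base
  field.\<close>

subsection \<open>Ring homomorphisms out of trivariate polynomial rings\<close>

locale comm_ring_hom =
  fixes h :: "'a::comm_ring_1 \<Rightarrow> 'b::comm_ring_1"
  assumes hom_add: "h (x + y) = h x + h y"
    and hom_mult: "h (x * y) = h x * h y"
    and hom_1: "h 1 = 1"
begin

lemma hom_0: "h 0 = 0"
  using hom_add[of 0 0] by simp

lemma hom_uminus: "h (- x) = - h x"
  using hom_add[of x "- x"] by (simp add: hom_0 eq_neg_iff_add_eq_0 add.commute)

lemma hom_diff: "h (x - y) = h x - h y"
  using hom_add[of x "- y"] by (simp add: hom_uminus)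

lemma hom_power: "h (x ^ n) = h x ^ n"
  by (induction n) (simp_all add: hom_1 hom_mult)

lemma hom_sum: "h (\<Sum>i\<in>A. f i) = (\<Sum>i\<in>A. h (f i))"
  by (induction A rule: infinite_finite_induct) (simp_all add: hom_0 hom_add)

lemmas hom_simps = hom_0 hom_1 hom_add hom_mult hom_uminus hom_diff hom_power

lemma map_poly_hom: "comm_ring_hom (map_poly h)"
proof
  show "map_poly h (p + q) = map_poly h p + map_poly h q" for p q
    by (intro poly_eqI) (simp add: coeff_map_poly hom_0 hom_add)
  show "map_poly h (p * q) = map_poly h p * map_poly h q" for p q
    by (intro poly_eqI) (simp add: coeff_map_poly hom_0 coeff_mult hom_sum hom_mult)
qed (simp add: hom_1)

lemma eval_hom: "comm_ring_hom (\<lambda>p. poly (map_poly h p) a)"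
proof -
  interpret m: comm_ring_hom "map_poly h" by (rule map_poly_hom)
  show ?thesis
    by standard (simp_all add: m.hom_simps)
qed

lemma hom_poly: "h (poly p a) = poly (map_poly h p) (h a)"
  by (induction p) (simp_all add: map_poly_pCons hom_simps)

end

lemma comm_ring_hom_comp:
  "comm_ring_hom f \<Longrightarrow> comm_ring_hom g \<Longrightarrow> comm_ring_hom (\<lambda>x. f (g x))"
  by (simp add: comm_ring_hom_def)

lemma comm_ring_hom_id: "comm_ring_hom (\<lambda>x. x)"
  by (simp add: comm_ring_hom_def)

lemma comm_ring_hom_C: "comm_ring_hom (\<lambda>c. [:c:])"
  by standard (simp_all add: one_pCons)

lemma comm_ring_hom_poly: "comm_ring_hom (\<lambda>p. poly p a)"
  by standard simp_all

section \<open>Induction and evaluation for nested polynomial rings\<close>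

lemma poly_subring_induct [case_names const var add mult]:
  assumes "\<And>c. Q [:c:]" "Q [:0, 1:]"
    and "\<And>p q. Q p \<Longrightarrow> Q q \<Longrightarrow> Q (p + q)" "\<And>p q. Q p \<Longrightarrow> Q q \<Longrightarrow> Q (p * q)"
  shows "Q (p :: 'a::comm_semiring_1 poly)"
proof (induction p)
  case 0
  then show ?case using assms(1)[of 0] by simp
next
  case (pCons a p)
  have "pCons a p = [:a:] + [:0, 1:] * p" by simp
  then show ?case using assms pCons by metis
qed

definition const3 :: "'a::comm_ring_1 \<Rightarrow> 'a poly poly poly" where
  "const3 c = [:[:[:c:]:]:]"

interpretation const3: comm_ring_hom const3
  by standard (simp_all add: one_pCons const3_def)

lemmas comm_ring_hom_const3 = const3.comm_ring_hom_axioms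

text \<open>Constants and the three variables generate the nested ring, layer by layer, so
  properties stable under sums and products are proved without triple coefficient sums.\<close>

lemma poly3_subring_induct [case_names const var_x var_y var_z add mult]:
  fixes P :: "'a::comm_ring_1 poly poly poly"
  assumes const: "\<And>c. Q (const3 c)" and vars: "Q var_x" "Q var_y" "Q var_z"
    and add: "\<And>p q. Q p \<Longrightarrow> Q q \<Longrightarrow> Q (p + q)" and mult: "\<And>p q. Q p \<Longrightarrow> Q q \<Longrightarrow> Q (p * q)"
  shows "Q P"
proof (induction P rule: poly_subring_induct)
  case (const c)
  show ?case
  proof (induction c rule: poly_subring_induct)
    case (const c)
    show ?case
    proof (induction c rule: poly_subring_induct)
      case (add p q)
      then show ?case using assms(5)[OF add] by (simp add: add.commute)
    next
      case (mult p q)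
      then show ?case using assms(6)[OF mult] by (simp add: mult.commute)
    qed (use assms in \<open>simp_all add: const3_def var_x_def\<close>)
  next
    case (add p q)
    then show ?case using assms(5)[OF add] by (simp add: add.commute)
  next
    case (mult p q)
    then show ?case using assms(6)[OF mult] by (simp add: mult.commute)
  qed (use vars in \<open>simp add: var_y_def\<close>)
qed (use assms in \<open>simp_all add: var_z_def\<close>)

lemma poly3_hom_eqI:
  assumes "comm_ring_hom f" "comm_ring_hom g"
    and "\<And>c. f (const3 c) = g (const3 c)"
    and "f var_x = g var_x" "f var_y = g var_y" "f var_z = g var_z"
  shows "f P = g P"
proof -
  interpret f: comm_ring_hom f by fact
  interpret g: comm_ring_hom g by fact
  show ?thesis
    by (induction P rule: poly3_subring_induct)
       (simp_all add: assms f.hom_add g.hom_add f.hom_mult g.hom_mult)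
qed

text \<open>For a ring homomorphism \<open>h\<close> this is its extension sending
  \<open>var_x\<close>, \<open>var_y\<close>, \<open>var_z\<close> to \<open>a\<close>,
  \<open>b\<close>, \<open>c\<close>; the innermost layer carries x and is evaluated first.\<close>

definition eval3 :: "('a::comm_ring_1 \<Rightarrow> 'b::comm_ring_1) \<Rightarrow> 'b \<Rightarrow> 'b \<Rightarrow> 'b \<Rightarrow> 'a poly poly poly \<Rightarrow> 'b"
  where "eval3 h a b c P =
    poly (map_poly (\<lambda>q. poly (map_poly (\<lambda>r. poly (map_poly h r) a) q) b) P) c"

lemma eval3_hom: "comm_ring_hom h \<Longrightarrow> comm_ring_hom (eval3 h a b c)"
  unfolding eval3_def by (intro comm_ring_hom.eval_hom)

lemma eval3_simps:
  assumes "comm_ring_hom h"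
  shows "eval3 h a b c (const3 k) = h k" "eval3 h a b c var_x = a"
    "eval3 h a b c var_y = b" "eval3 h a b c var_z = c"
proof -
  interpret h: comm_ring_hom h by fact
  show "eval3 h a b c (const3 k) = h k" "eval3 h a b c var_x = a"
    "eval3 h a b c var_y = b" "eval3 h a b c var_z = c"
    by (simp_all add: eval3_def map_poly_pCons h.hom_0 h.hom_1 const3_def var_x_def var_y_def var_z_def)
qed

definition map_poly3 :: "('a::comm_ring_1 \<Rightarrow> 'b::comm_ring_1) \<Rightarrow> 'a poly poly poly \<Rightarrow> 'b poly poly poly"
  where "map_poly3 h = map_poly (map_poly (map_poly h))"

lemma map_poly3_hom: "comm_ring_hom h \<Longrightarrow> comm_ring_hom (map_poly3 h)"
  unfolding map_poly3_def by (intro comm_ring_hom.map_poly_hom)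

lemma map_poly3_simps:
  assumes "comm_ring_hom h"
  shows "map_poly3 h (const3 c) = const3 (h c)" "map_poly3 h var_x = var_x"
    "map_poly3 h var_y = var_y" "map_poly3 h var_z = var_z"
proof -
  interpret h: comm_ring_hom h by fact
  show "map_poly3 h (const3 c) = const3 (h c)" "map_poly3 h var_x = var_x"
    "map_poly3 h var_y = var_y" "map_poly3 h var_z = var_z"
    by (simp_all add: map_poly3_def map_poly_pCons h.hom_0 h.hom_1 const3_def var_x_def var_y_def var_z_def)
qed

lemma coeff_map_poly3:
  "h 0 = 0 \<Longrightarrow> coeff (coeff (coeff (map_poly3 h P) i) j) l = h (coeff (coeff (coeff P i) j) l)"
  by (simp add: map_poly3_def coeff_map_poly)

lemma poly3_eqI:
  "(\<And>i j l. coeff (coeff (coeff P i) j) l = coeff (coeff (coeff Q i) j) l) \<Longrightarrow> P = Q"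
  by (intro poly_eqI)

subsection \<open>The polynomials attached to monomials\<close>

lemma char2_add_self: "CHAR('a::comm_ring_1) = 2 \<Longrightarrow> x + x = (0::'a)"
  by (metis minus_CHAR_2 diff_self)

lemma char2_add_left: "CHAR('a::comm_ring_1) = 2 \<Longrightarrow> x + (x + y) = (y::'a)"
  by (metis add.assoc add_0 char2_add_self)

lemma char2_power_add:
  "CHAR('a::comm_ring_1) = 2 \<Longrightarrow> (x + y) ^ (2 ^ n) = x ^ (2 ^ n) + (y::'a) ^ (2 ^ n)"
  by (rule freshmans_dream') auto

lemmas char2_simps = char2_add_self char2_add_left minus_CHAR_2 uminus_CHAR_2

definition pow_sum :: "nat \<Rightarrow> 'a::comm_ring_1 \<Rightarrow> 'a \<Rightarrow> 'a \<Rightarrow> 'a" where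
  "pow_sum j x y z = x ^ j + y ^ j + z ^ j + (x + y + z) ^ j"

text \<open>In characteristic 2 the elements x, y, z, x + y + z have sum 0, so their power sums satisfy
  the recursion below; its solution with initial values 0, 0, 0, 1 is the complete homogeneous
  symmetric polynomial of degree j - 3 in these four elements.\<close>

fun phi_pow :: "nat \<Rightarrow> 'a::comm_ring_1 \<Rightarrow> 'a \<Rightarrow> 'a \<Rightarrow> 'a" where
  "phi_pow 0 x y z = 0"
| "phi_pow (Suc 0) x y z = 0"
| "phi_pow (Suc (Suc 0)) x y z = 0"
| "phi_pow (Suc (Suc (Suc 0))) x y z = 1"
| "phi_pow (Suc (Suc (Suc (Suc j)))) x y z =
     x * y * z * (x + y + z) * phi_pow j x y z
     + (x * y * z + (x * y + x * z + y * z) * (x + y + z)) * phi_pow (Suc j) x y z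
     + (x * y + x * z + y * z + (x + y + z) ^ 2) * phi_pow (Suc (Suc j)) x y z"

text \<open>\<open>phi_pow\<close> is a polynomial expression with integer coefficients, hence
  natural in the ring. This carries it between trivariate polynomials, their specializations and
  field elements.\<close>

lemma phi_pow_hom:
  "comm_ring_hom h \<Longrightarrow> h (phi_pow j x y z) = phi_pow j (h x) (h y) (h z)"
  by (induction j x y z rule: phi_pow.induct) (simp_all add: comm_ring_hom.hom_simps)

text \<open>Homogeneity of degree j - 3, with \<open>t ^ 3\<close> on the left so that no truncated
  subtraction occurs for j < 3.\<close>

lemma phi_pow_homogeneous:
  "t ^ 3 * phi_pow j (t * x) (t * y) (t * z) = t ^ j * phi_pow j x y z"
proof (induction j x y z rule: phi_pow.induct)
  case (5 j x y z)
  have eq: "t ^ 3 * (t * x * (t * y) * (t * z) * (t * x + t * y + t * z) * p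
     + (t * x * (t * y) * (t * z) + (t * x * (t * y) + t * x * (t * z) + t * y * (t * z)) * (t * x + t * y + t * z)) * q
     + (t * x * (t * y) + t * x * (t * z) + t * y * (t * z) + (t * x + t * y + t * z) ^ 2) * r)
    = t ^ 4 * (x * y * z * (x + y + z)) * (t ^ 3 * p)
     + t ^ 3 * (x * y * z + (x * y + x * z + y * z) * (x + y + z)) * (t ^ 3 * q)
     + t ^ 2 * (x * y + x * z + y * z + (x + y + z) ^ 2) * (t ^ 3 * r)" for p q r
    by (simp add: algebra_simps power2_eq_square numeral_eq_Suc)
  have eq': "t ^ 4 * a * (t ^ j * p) + t ^ 3 * b * (t ^ Suc j * q) + t ^ 2 * c * (t ^ Suc (Suc j) * r)
      = t ^ Suc (Suc (Suc (Suc j))) * (a * p + b * q + c * r)" for a b c p q r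
    by (simp add: algebra_simps numeral_eq_Suc)
  show ?case
    by (simp only: phi_pow.simps eq 5 eq')
qed (simp_all add: numeral_eq_Suc)

lemma phi_pow_mult_eq:
  fixes x :: "'a::comm_ring_1"
  assumes "CHAR('a) = 2"
  shows "(x + y) * (x + z) * (y + z) * phi_pow j x y z = pow_sum j x y z"
proof (induction j x y z rule: phi_pow.induct)
  case (5 j x y z)
  \<comment> \<open>Elementary symmetric functions of x, y, z, x + y + z. The first one is 0 in
    characteristic 2, so all four elements satisfy T^4 = e4 + e3 T + e2 T^2 and their power sums
    inherit the recursion.\<close>
  define e2 e3 e4 where "e2 = x * y + x * z + y * z + (x + y + z) ^ 2"
    and "e3 = x * y * z + (x * y + x * z + y * z) * (x + y + z)"
    and "e4 = x * y * z * (x + y + z)"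
  note e_defs = this
  have step: "r ^ Suc (Suc (Suc (Suc j))) = e4 * r ^ j + e3 * r ^ Suc j + e2 * r ^ Suc (Suc j)"
    if "r ^ 4 = e4 + e3 * r + e2 * r ^ 2" for r
  proof -
    have "r ^ Suc (Suc (Suc (Suc j))) = r ^ j * r ^ 4"
      by (simp add: numeral_eq_Suc algebra_simps)
    then show ?thesis
      by (simp add: that algebra_simps power2_eq_square)
  qed
  have "x ^ 4 = e4 + e3 * x + e2 * x ^ 2" "y ^ 4 = e4 + e3 * y + e2 * y ^ 2"
    "z ^ 4 = e4 + e3 * z + e2 * z ^ 2"
    "(x + y + z) ^ 4 = e4 + e3 * (x + y + z) + e2 * (x + y + z) ^ 2"
    by (simp_all add: e_defs algebra_simps power2_eq_square numeral_eq_Suc char2_simps assms)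
  note roots = this[THEN step]
  have "pow_sum (Suc (Suc (Suc (Suc j)))) x y z
      = e4 * pow_sum j x y z + e3 * pow_sum (Suc j) x y z + e2 * pow_sum (Suc (Suc j)) x y z"
    unfolding pow_sum_def roots by (simp only: distrib_left add_ac)
  moreover have "u * phi_pow (Suc (Suc (Suc (Suc j)))) x y z
      = e4 * (u * phi_pow j x y z) + e3 * (u * phi_pow (Suc j) x y z)
        + e2 * (u * phi_pow (Suc (Suc j)) x y z)" for u
    by (simp only: phi_pow.simps e_defs[symmetric]) (simp add: algebra_simps)
  ultimately show ?case
    by (simp only: 5)
next
  case (1 x y z)
  show ?case
    by (simp only: pow_sum_def power_0 char2_add_self[OF assms] add_0_left phi_pow.simps mult_zero_right)
qed (use assms in \<open>simp_all add: pow_sum_def char2_simps algebra_simps power2_eq_square numeral_eq_Suc char2_power_add\<close>)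

text \<open>Division-free form of \<open>phi\<close>; in characteristic 2 the two agree, by
  \<open>phi_pow_mult_eq\<close> applied to each monomial.\<close>

definition Phi :: "'a::comm_ring_1 poly \<Rightarrow> 'a poly poly poly" where
  "Phi f = (\<Sum>j\<le>degree f. const3 (coeff f j) * phi_pow j var_x var_y var_z)"

lemma Phi_eq_sum:
  assumes "degree f \<le> N"
  shows "Phi f = (\<Sum>j\<le>N. const3 (coeff f j) * phi_pow j var_x var_y var_z)"
  unfolding Phi_def using assms
  by (intro sum.mono_neutral_left) (auto simp: coeff_eq_0 const3.hom_0 intro!: le_degree)

lemma map_poly3_Phi:
  assumes "comm_ring_hom h"
  shows "map_poly3 h (Phi f) = Phi (map_poly h f)"
proof -
  interpret m: comm_ring_hom "map_poly3 h" using assms by (rule map_poly3_hom)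
  have "Phi (map_poly h f) = (\<Sum>j\<le>degree f. const3 (coeff (map_poly h f) j) * phi_pow j var_x var_y var_z)"
    by (intro Phi_eq_sum map_poly_degree_leq)
  then show ?thesis
    using comm_ring_hom.hom_0[OF assms]
    by (simp add: Phi_def m.hom_sum m.hom_mult phi_pow_hom[OF m.comm_ring_hom_axioms]
        map_poly3_simps[OF assms] coeff_map_poly)
qed

lemma subst3_eq_sum: "subst3 f P = (\<Sum>j\<le>degree f. const3 (coeff f j) * P ^ j)"
proof -
  have "subst3 f P = poly (map_poly const3 f) P"
    by (simp add: subst3_def const3_def[abs_def])
  also have "\<dots> = (\<Sum>j\<le>degree f. coeff (map_poly const3 f) j * P ^ j)"
    unfolding poly_altdef
    by (intro sum.mono_neutral_left) (auto simp: map_poly_degree_leq coeff_eq_0)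
  finally show ?thesis
    by (simp add: coeff_map_poly const3.hom_0)
qed

lemma var_sums_nonzero:
  shows "var_x + var_y \<noteq> (0 :: 'a::comm_ring_1 poly poly poly)" "var_x + var_z \<noteq> (0 :: 'a poly poly poly)"
    "var_y + var_z \<noteq> (0 :: 'a poly poly poly)"
  by (simp_all add: var_x_def var_y_def var_z_def)

lemma phi_eq_Phi:
  fixes f :: "'a::field poly"
  assumes "CHAR('a) = 2"
  shows "phi f = Phi f"
proof -
  let ?D = "(var_x + var_y) * (var_x + var_z) * (var_y + var_z) :: 'a poly poly poly"
  have "subst3 f var_x + subst3 f var_y + subst3 f var_z + subst3 f (var_x + var_y + var_z)
      = (\<Sum>j\<le>degree f. const3 (coeff f j) * pow_sum j var_x var_y var_z)"
    by (simp only: subst3_eq_sum pow_sum_def distrib_left sum.distrib)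
  also have "\<dots> = (\<Sum>j\<le>degree f. const3 (coeff f j) * (?D * phi_pow j var_x var_y var_z))"
    using assms by (subst phi_pow_mult_eq) simp_all
  also have "\<dots> = Phi f * ?D"
    by (simp only: Phi_def sum_distrib_left mult_ac)
  finally show ?thesis
    using var_sums_nonzero by (simp only: phi_def) (rule nonzero_mult_div_cancel_right, simp)
qed

subsection \<open>Homogeneous components\<close>

text \<open>The outermost variable T of the target marks the total degree: the coefficient of T^m in the image
  of P is the homogeneous component of degree m of P.\<close>

definition homog :: "'a::comm_ring_1 poly poly poly \<Rightarrow> 'a poly poly poly poly" where
  "homog = eval3 (\<lambda>c. [:const3 c:]) (monom var_x 1) (monom var_y 1) (monom var_z 1)"

lemma comm_ring_hom_C_const3: "comm_ring_hom (\<lambda>c. [:const3 c:])"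
  by (intro comm_ring_hom_comp[OF comm_ring_hom_C] comm_ring_hom_const3)

interpretation homog: comm_ring_hom homog
  unfolding homog_def by (intro eval3_hom comm_ring_hom_C_const3)

lemma homog_simps:
  "homog (const3 c) = [:const3 c:]" "homog var_x = monom var_x 1"
  "homog var_y = monom var_y 1" "homog var_z = monom var_z 1"
  by (simp_all only: homog_def eval3_simps[OF comm_ring_hom_C_const3])

lemma poly_homog_1 [simp]: "poly (homog P) 1 = P"
  by (rule poly3_hom_eqI[OF comm_ring_hom_comp[OF comm_ring_hom_poly homog.comm_ring_hom_axioms]
        comm_ring_hom_id])
     (simp_all add: homog_simps poly_monom)

lemma homog_eq_0_iff [simp]: "homog P = 0 \<longleftrightarrow> P = 0"
  by (metis homog.hom_0 poly_0 poly_homog_1)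

text \<open>A form of total degree m has degree at most m in z, the outermost variable; this bounds
  the number of its zeros in z.\<close>

lemma degree_coeff_homog: "degree (coeff (homog P) m) \<le> m"
proof (induction P arbitrary: m rule: poly3_subring_induct)
  case (const c)
  show ?case by (cases m) (simp_all only: homog_simps, simp_all add: const3_def)
next
  case (add p q)
  then show ?case by (simp add: homog.hom_add degree_add_le)
next
  case (mult p q)
  show ?case
    unfolding homog.hom_mult coeff_mult
  proof (intro degree_sum_le)
    fix i assume "i \<in> {..m}"
    then show "degree (coeff (homog p) i * coeff (homog q) (m - i)) \<le> m"
      using degree_mult_le[of "coeff (homog p) i" "coeff (homog q) (m - i)"]
        mult(1)[of i] mult(2)[of "m - i"] by simp
  qed simp
qed (simp_all add: homog_simps coeff_monom, simp_all add: var_x_def var_y_def var_z_def)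

lemma coeff_homog_0_const: "\<exists>c. coeff (homog P) 0 = const3 c"
proof (induction P rule: poly3_subring_induct)
  case (add p q)
  then show ?case by (auto simp: homog.hom_add simp flip: const3.hom_add)
next
  case (mult p q)
  then show ?case by (auto simp: homog.hom_mult coeff_mult simp flip: const3.hom_mult)
qed (auto simp: homog_simps intro: exI[of _ 0] const3.hom_0)

text \<open>The degree of \<open>homog P\<close> is the total degree, which is additive over a
  field, and a polynomial of total degree 0 is a scalar. Non-unit factors thus have positive total
  degree.\<close>

lemma is_unit_iff_degree_homog:
  fixes P :: "'a::field poly poly poly"
  assumes "P \<noteq> 0"
  shows "P dvd 1 \<longleftrightarrow> degree (homog P) = 0"
proof
  assume "P dvd 1"
  then obtain Q where "1 = P * Q" ..
  then have "homog P * homog Q = 1" by (metis homog.hom_1 homog.hom_mult)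
  then show "degree (homog P) = 0"
    by (metis degree_1 degree_mult_eq_0 dvd_triv_left is_unit_iff_degree mult_not_zero one_neq_zero add_is_0 degree_mult_eq)
next
  assume "degree (homog P) = 0"
  then have "homog P = [:coeff (homog P) 0:]" by (metis degree_0_id)
  moreover obtain c where "coeff (homog P) 0 = const3 c" using coeff_homog_0_const by blast
  ultimately have "homog P = [:const3 c:]" by simp
  then have P: "P = const3 c" by (metis poly_homog_1 poly_const_conv)
  then have "P * const3 (inverse c) = 1" using assms by (simp add: one_pCons const3_def)
  then show "P dvd 1" by (metis dvd_triv_left)
qed

lemma homog_phi_pow:
  "homog (phi_pow (m + 3) var_x var_y var_z :: 'a::comm_ring_1 poly poly poly)
     = monom (phi_pow (m + 3) var_x var_y var_z) m"
proof -
  let ?c = "\<lambda>v :: 'a poly poly poly. [:v:]" and ?T = "[:0, 1:] :: 'a poly poly poly poly"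
  have "homog (phi_pow (m + 3) var_x var_y var_z)
      = phi_pow (m + 3) (?T * ?c var_x) (?T * ?c var_y) (?T * ?c var_z)"
    by (simp add: phi_pow_hom[OF homog.comm_ring_hom_axioms] homog_simps monom_altdef del: phi_pow.simps)
  then have "?T ^ 3 * homog (phi_pow (m + 3) var_x var_y var_z)
      = ?T ^ 3 * phi_pow (m + 3) (?T * ?c var_x) (?T * ?c var_y) (?T * ?c var_z)"
    by (simp only:)
  also have "\<dots>
      = ?T ^ 3 * (?T ^ m * phi_pow (m + 3) (?c var_x) (?c var_y) (?c var_z))"
    by (subst phi_pow_homogeneous) (simp add: power_add mult_ac del: phi_pow.simps)
  also have "phi_pow (m + 3) (?c var_x) (?c var_y) (?c var_z) = ?c (phi_pow (m + 3) var_x var_y var_z)"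
    by (simp add: phi_pow_hom[OF comm_ring_hom_C])
  also have "?T ^ m * \<dots> = monom (phi_pow (m + 3) var_x var_y var_z) m"
    by (simp add: monom_altdef)
  finally have *: "?T ^ 3 * homog (phi_pow (m + 3) var_x var_y var_z)
      = ?T ^ 3 * monom (phi_pow (m + 3) var_x var_y var_z) m" .
  \<comment> \<open>The factor T^3 from \<open>phi_pow_homogeneous\<close> is cancelled by comparing
    coefficients three places higher.\<close>
  have T3: "?T ^ 3 = monom 1 3" by (simp add: monom_altdef)
  show ?thesis
  proof (rule poly_eqI)
    fix i
    show "coeff (homog (phi_pow (m + 3) var_x var_y (var_z :: 'a poly poly poly))) i
        = coeff (monom (phi_pow (m + 3) var_x var_y var_z) m) i"
      using arg_cong[OF *[unfolded T3], of "\<lambda>p. coeff p (i + 3)"] by (simp add: coeff_monom_mult)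
  qed
qed

text \<open>\<open>phi_pow j\<close> is 0 or a form of degree j - 3, so only the monomial of
  exponent m + 3 reaches degree m.\<close>

lemma coeff_homog_Phi:
  "coeff (homog (Phi f)) m = const3 (coeff f (m + 3)) * phi_pow (m + 3) var_x var_y var_z"
proof -
  let ?q = "\<lambda>j. const3 (coeff f j) * phi_pow j var_x var_y var_z"
  have *: "coeff (homog (?q j)) m = (if j = m + 3 then ?q j else 0)" for j
  proof (cases "j < 3")
    case True
    then have "j = 0 \<or> j = 1 \<or> j = 2" by auto
    then have "phi_pow j var_x var_y (var_z :: 'a poly poly poly) = 0" by (auto simp: numeral_eq_Suc)
    then show ?thesis using True by (simp add: homog.hom_0)
  next
    case False
    then obtain i where "j = i + 3" by (metis add.commute le_Suc_ex not_less)
    then show ?thesis by (simp add: homog.hom_mult homog_simps homog_phi_pow del: phi_pow.simps)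
  qed
  \<comment> \<open>The summation range is enlarged so that it surely contains the index m +
    3.\<close>
  have "degree f \<le> degree f + m + 3" by simp
  then have "coeff (homog (Phi f)) m = (\<Sum>j\<le>degree f + m + 3. if j = m + 3 then ?q j else 0)"
    by (simp only: Phi_eq_sum homog.hom_sum coeff_sum *)
  also have "\<dots> = ?q (m + 3)" by (subst sum.delta) simp_all
  finally show ?thesis .
qed

lemma char2_two: "CHAR('a::comm_ring_1) = 2 \<Longrightarrow> (2::'a) = 0"
  by (metis of_nat_CHAR of_nat_numeral)

subsection \<open>Roots of the Gold polynomial\<close>

text \<open>T^(2^k) - T splits over an algebraically closed field, and its derivative is -1, so it
  has no double root.\<close>

lemma card_frobenius_fixed:
  assumes char: "CHAR('a::alg_closed_field) = 2" and "k > 0"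
  shows "card {a :: 'a. a ^ (2 ^ k) = a} = 2 ^ k"
proof -
  define p :: "'a poly" where "p = monom 1 (2 ^ k) - monom 1 1"
  have k2: "(1::nat) < 2 ^ k" using \<open>k > 0\<close> by (intro one_less_power) simp_all
  have deg: "degree p = 2 ^ k"
    unfolding p_def diff_conv_add_uminus using k2
    by (subst degree_add_eq_left) (simp_all add: degree_monom_eq)
  then have "p \<noteq> 0" by auto
  have "of_nat (2 ^ k) = (0::'a)"
    using char \<open>k > 0\<close> by (simp add: of_nat_eq_0_iff_char_dvd del: of_nat_power)
  then have deriv: "pderiv p = - 1"
    by (simp add: p_def pderiv_diff pderiv_monom del: of_nat_power)
  obtain A where A: "size A = degree p" "p = smult (lead_coeff p) (\<Prod>x\<in>#A. [:- x, 1:])"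
    using alg_closed_imp_factorization[OF \<open>p \<noteq> 0\<close>] by blast
  have "count A x = 1" if "x \<in># A" for x
  proof (rule ccontr)
    assume "count A x \<noteq> 1"
    with that have "count A x > 1" using count_greater_zero_iff[of A x] by linarith
    moreover from that obtain B' where B': "A = add_mset x B'" by (auto dest: multi_member_split)
    ultimately have "x \<in># B'" by simp
    with B' obtain B where B: "A = add_mset x (add_mset x B)" by (auto dest: multi_member_split)
    have "p = [:- x, 1:] * ([:- x, 1:] * smult (lead_coeff p) (\<Prod>x\<in>#B. [:- x, 1:]))"
      by (subst A(2)) (simp only: B image_mset_add_mset prod_mset.add_mset mult_smult_right)
    then obtain r where "p = [:- x, 1:] * ([:- x, 1:] * r)" ..
    then have "poly (pderiv p) x = 0" by (simp only: pderiv_mult poly_add poly_mult) simp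
    then show False using deriv by simp
  qed
  then have "count A x = count (mset_set (set_mset A)) x" for x
    by (cases "x \<in># A") (simp_all add: count_mset_set not_in_iff)
  then have "A = mset_set (set_mset A)" by (rule multiset_eqI)
  then have "size (mset_set (set_mset A)) = size A" by (rule arg_cong[OF sym])
  then have "card (set_mset A) = size A" by (simp only: size_mset_set)
  moreover have "poly p a = 0 \<longleftrightarrow> a \<in># A" for a
  proof -
    have "poly p a = lead_coeff p * (\<Prod>x\<in>#A. a - x)"
      by (subst A(2)) (simp add: poly_prod_mset)
    then show ?thesis using \<open>p \<noteq> 0\<close> by (auto simp: prod_mset_zero_iff)
  qed
  then have "{a. a ^ (2 ^ k) = a} = set_mset A"
    by (auto simp: p_def poly_monom)
  ultimately show ?thesis using A(1) deg by simp
qed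

text \<open>For odd k one has 2^k = 2 * 4^i, so a^4 = a turns a^(2^k) = a into a^2 = a. In
  characteristic 2 this says that GF(4) and GF(2^k) meet in GF(2).\<close>

lemma frobenius_fixed_no_cube_root:
  fixes a :: "'a::field"
  assumes "odd k" "a ^ (2 ^ k) = a" "a ^ 4 = a"
  shows "a = 0 \<or> a = 1"
proof -
  obtain i where k: "k = 2 * i + 1" using assms(1) oddE by blast
  have "a ^ (4 ^ i) = a"
    by (induction i) (simp_all add: power_mult assms(3))
  moreover have "(2::nat) ^ k = 4 ^ i * 2"
    by (simp add: k power_mult)
  then have "a ^ (2 ^ k) = (a ^ (4 ^ i)) ^ 2"
    by (simp only: power_mult)
  ultimately have "a * (a - 1) = 0"
    using assms(2) by (simp add: power2_eq_square algebra_simps)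
  then show ?thesis by simp
qed

text \<open>This form shows where the Gold power sum vanishes: on x + z = c (y + z) with c fixed by
  the k-th power of Frobenius.\<close>

lemma pow_sum_gold:
  assumes "CHAR('a::comm_ring_1) = 2"
  shows "pow_sum (2 ^ k + 1) x y (z::'a) = (x + z) ^ (2 ^ k) * (y + z) + (x + z) * (y + z) ^ (2 ^ k)"
  by (simp add: pow_sum_def char2_power_add assms algebra_simps char2_simps)

text \<open>The zero in z of x + a y + (1 + a) z, one of the linear factors of the Gold polynomial.\<close>

definition gold_root :: "'a::field \<Rightarrow> 'a poly poly" where
  "gold_root a = [:[:0, inverse (1 + a):], [:a * inverse (1 + a):]:]"

lemma gold_root_eq:
  assumes "CHAR('a::field) = 2" "a \<noteq> (1::'a)"
  shows "[:[:1 + a:]:] * gold_root a = [:[:0, 1:], [:a:]:]"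
proof -
  have "1 + a \<noteq> 0" using assms by (metis add_eq_0_iff2 uminus_CHAR_2)
  then show ?thesis by (simp add: gold_root_def)
qed

lemma gold_root_inj:
  assumes "CHAR('a::field) = 2"
  shows "inj (gold_root :: 'a \<Rightarrow> _)"
  by (rule injI) (simp add: gold_root_def)

lemma poly_phi_pow:
  "poly (phi_pow j var_x var_y var_z) r = phi_pow j [:[:0, 1:]:] [:0, 1:] r"
  by (simp add: phi_pow_hom[OF comm_ring_hom_poly]) (simp add: var_x_def var_y_def var_z_def)

text \<open>With z = \<open>gold_root a\<close> one has x + z = a (y + z), where
  \<open>pow_sum_gold\<close> gives 0, while the three factors of the denominator stay
  nonzero.\<close>

lemma poly_gold_root_eq_0:
  assumes char: "CHAR('a::field) = 2" and a: "a ^ (2 ^ k) = a" "a \<noteq> 0" "a \<noteq> (1::'a)"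
  shows "poly (phi_pow (2 ^ k + 1) var_x var_y var_z) (gold_root a) = 0"
proof -
  define x y r c where "x = [:[:0, 1::'a:]:]" and "y = [:0, 1::'a poly:]" and "r = gold_root a"
    and "c = [:[:a:]:]"
  have "c \<noteq> 0" "1 + c \<noteq> 0"
    using a by (auto simp: c_def one_pCons) (metis add_eq_0_iff2 uminus_CHAR_2 char)
  have root: "(1 + c) * r = x + c * y"
    using gold_root_eq[OF char a(3)] by (simp add: c_def r_def x_def y_def one_pCons)
  have cpow: "c ^ (2 ^ k) = c"
    by (simp add: c_def poly_const_pow a)
  have char': "CHAR('a poly poly) = 2" using char by simp
  have "(1 + c) * (x + r) = c * (x + y)" "(1 + c) * (y + r) = x + y"
    using root by (simp_all add: algebra_simps char2_simps[OF char'])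
  then have xr: "x + r = c * (y + r)" and "y + r \<noteq> 0"
    using \<open>1 + c \<noteq> 0\<close>
    by (metis mult_left_cancel mult.left_commute, auto simp: x_def y_def)
  have "x + y = (1 + c) * (y + r)"
    using \<open>(1 + c) * (y + r) = x + y\<close> by simp
  then have "(x + y) * (x + r) * (y + r) \<noteq> 0"
    using xr \<open>y + r \<noteq> 0\<close> \<open>1 + c \<noteq> 0\<close> \<open>c \<noteq> 0\<close> by simp
  moreover have "pow_sum (2 ^ k + 1) x y r = 0"
    unfolding pow_sum_gold[OF char'] xr
    by (simp only: power_mult_distrib cpow mult_ac char2_add_self[OF char'])
  ultimately have "phi_pow (2 ^ k + 1) x y r = 0"
    using phi_pow_mult_eq[OF char', of x y r "2 ^ k + 1"] by (metis mult_eq_0_iff)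
  then show ?thesis
    unfolding poly_phi_pow x_def y_def r_def .
qed

text \<open>At x = a, y = 1 the root specializes to z = 0. There the power sum is a^(2^(k-1)) + a^2;
  if it were 0, squaring would give a = a^4, which \<open>frobenius_fixed_no_cube_root\<close>
  excludes.\<close>

lemma poly_gold_root_neq_0:
  assumes char: "CHAR('a::field) = 2" and k: "odd k"
    and a: "a ^ (2 ^ k) = a" "a \<noteq> 0" "a \<noteq> (1::'a)"
  shows "poly (phi_pow (2 ^ (k - 1) + 2) var_x var_y var_z) (gold_root a) \<noteq> 0"
proof
  let ?m = "2 ^ (k - 1) + 2 :: nat"
  have hom: "comm_ring_hom (\<lambda>w :: 'a poly poly. poly (poly w 1) a)"
    by (intro comm_ring_hom_comp[OF comm_ring_hom_poly] comm_ring_hom_poly)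
  assume "poly (phi_pow ?m var_x var_y var_z) (gold_root a) = 0"
  then have "poly (poly (phi_pow ?m [:[:0, 1:]:] [:0, 1:] (gold_root a)) 1) a = 0"
    unfolding poly_phi_pow by simp
  then have "phi_pow ?m a 1 0 = 0"
    unfolding phi_pow_hom[OF hom]
    by (simp add: gold_root_def char2_simps[OF char] algebra_simps)
  then have "pow_sum ?m a 1 0 = 0"
    using phi_pow_mult_eq[OF char, of a 1 0 ?m] by simp
  then have "a ^ (2 ^ (k - 1)) = a ^ 2"
    by (simp add: pow_sum_def power_add char2_power_add[OF char] algebra_simps power2_eq_square
        char2_simps[OF char]) (metis add_eq_0_iff2 uminus_CHAR_2 char)
  then have "(a ^ (2 ^ (k - 1))) ^ 2 = (a ^ 2) ^ 2" by simp
  moreover have "(2::nat) ^ (k - 1) * 2 = 2 ^ k" using k by (cases k) simp_all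
  ultimately have "a ^ 4 = a"
    using a(1) by (simp flip: power_mult)
  then show False
    using frobenius_fixed_no_cube_root[OF k a(1)] a by blast
qed

text \<open>A counting argument: p and q have at most s and t zeros in S but together cover all s +
  t elements, so both bounds are attained and no zero is shared.\<close>

lemma roots_split:
  fixes p q :: "'a::idom poly"
  assumes "finite S" "card S = s + t" "\<forall>r\<in>S. poly (p * q) r = 0"
    and "p \<noteq> 0" "q \<noteq> 0" "degree p \<le> s" "degree q \<le> t"
  shows "card {r \<in> S. poly q r = 0} = t" "\<And>r. r \<in> S \<Longrightarrow> poly p r = 0 \<longleftrightarrow> poly q r \<noteq> 0"
proof -
  let ?A = "{r \<in> S. poly p r = 0}" and ?B = "{r \<in> S. poly q r = 0}"
  have fin: "finite ?A" "finite ?B" using assms(1) by auto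
  have A: "card ?A \<le> s"
    using card_mono[of "{r. poly p r = 0}" ?A] poly_roots_finite[OF \<open>p \<noteq> 0\<close>]
      card_poly_roots_bound[OF \<open>p \<noteq> 0\<close>] assms(6) by fastforce
  have B: "card ?B \<le> t"
    using card_mono[of "{r. poly q r = 0}" ?B] poly_roots_finite[OF \<open>q \<noteq> 0\<close>]
      card_poly_roots_bound[OF \<open>q \<noteq> 0\<close>] assms(7) by fastforce
  have "S = ?A \<union> ?B" using assms(3) by auto
  then have "s + t + card (?A \<inter> ?B) = card ?A + card ?B"
    using card_Un_Int[OF fin] assms(2) by simp
  with A B have "card ?B = t" "card (?A \<inter> ?B) = 0" by linarith+
  then show "card ?B = t" "\<And>r. r \<in> S \<Longrightarrow> poly p r = 0 \<longleftrightarrow> poly q r \<noteq> 0"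
    using fin assms(3) by auto
qed

text \<open>At the t zeros of q in S the factor p does not vanish, so u must; its degree is too
  small for that many zeros.\<close>

lemma roots_split_mult_eq_0:
  fixes p q u v :: "'a::idom poly"
  assumes "finite S" "card S = s + t" "\<forall>r\<in>S. poly (p * q) r = 0"
    and "p \<noteq> 0" "q \<noteq> 0" "degree p \<le> s" "degree q \<le> t"
    and "p * u + v * q = 0" "degree u < t"
  shows "u = 0"
proof (rule ccontr)
  assume "u \<noteq> 0"
  have "poly u r = 0" if "r \<in> S" "poly q r = 0" for r
    using roots_split(2)[OF assms(1-7)] that arg_cong[OF assms(8), of "\<lambda>w. poly w r"] by auto
  then have "card {r \<in> S. poly q r = 0} \<le> card {r. poly u r = 0}"
    using poly_roots_finite[OF \<open>u \<noteq> 0\<close>] by (intro card_mono) auto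
  then show False
    using roots_split(1)[OF assms(1-7)] card_poly_roots_bound[OF \<open>u \<noteq> 0\<close>] assms(9) by simp
qed

subsection \<open>Restriction to the line (1, V, 0)\<close>

text \<open>Restriction turns identities between forms into identities between univariate
  polynomials in V, whose lowest coefficients can be compared.\<close>

definition line :: "'a::comm_ring_1 poly poly poly \<Rightarrow> 'a poly" where
  "line = eval3 (\<lambda>c. [:c:]) 1 [:0, 1:] 0"

interpretation line: comm_ring_hom line
  unfolding line_def by (intro eval3_hom comm_ring_hom_C)

lemma line_const3: "line (const3 c) = [:c:]"
  by (simp add: line_def eval3_simps[OF comm_ring_hom_C])

lemma line_phi_pow:
  assumes char: "CHAR('a::comm_ring_1) = 2"
  shows "[:0, 1:] * ([:1, 1:] * line (phi_pow j var_x var_y (var_z :: 'a poly poly poly)))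
     = 1 + [:0, 1:] ^ j + [:1, 1:] ^ j + 0 ^ j"
proof -
  have "line (phi_pow j var_x var_y var_z) = phi_pow j 1 [:0, 1::'a:] 0"
    unfolding phi_pow_hom[OF line.comm_ring_hom_axioms]
    by (simp add: line_def eval3_simps[OF comm_ring_hom_C])
  moreover have "1 + [:0, 1:] = [:1, 1::'a:]" by (simp add: one_pCons)
  ultimately show ?thesis
    using phi_pow_mult_eq[of 1 "[:0, 1::'a:]" 0 j] char by (simp add: pow_sum_def algebra_simps)
qed

section \<open>Nonvanishing of \<open>phi_pow\<close> away from the powers of 2\<close>

lemma power_one_plus_expand: "\<exists>r. (1 + u) ^ m = 1 + of_nat m * u + u ^ 2 * (r :: 'a::comm_ring_1)"
proof (induction m)
  case (Suc m)
  then obtain r where "(1 + u) ^ m = 1 + of_nat m * u + u ^ 2 * r" ..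
  then have "(1 + u) ^ Suc m = 1 + of_nat (Suc m) * u + u ^ 2 * (of_nat m + r + u * r)"
    by (simp add: algebra_simps power2_eq_square)
  then show ?case ..
qed (auto intro: exI[of _ 0])

text \<open>Write j = 2^i m with m odd. Then (1 + V)^j = (1 + V^(2^i))^m has coefficient m = 1 at
  V^(2^i), and 1 + V^j has a nonzero coefficient there only if j = 2^i.\<close>

lemma char2_binomial_eq_imp_power_of_2:
  assumes char: "CHAR('a::idom) = 2" and "j > 0" and eq: "[:1, 1::'a:] ^ j = 1 + monom 1 j"
  shows "\<exists>i. j = 2 ^ i"
proof -
  have char': "CHAR('a poly) = 2" using char by simp
  have "\<exists>m. j = 2 ^ multiplicity 2 j * m \<and> odd m"
    using multiplicity_decompose'[of j 2] \<open>j > 0\<close> by auto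
  then obtain i m where j: "j = 2 ^ i * m" and m: "odd m" by blast
  define u where "u = monom (1::'a) (2 ^ i)"
  have "[:1, 1::'a:] = 1 + monom 1 1" by (simp add: monom_altdef one_pCons)
  then have "[:1, 1::'a:] ^ (2 ^ i) = 1 + u"
    by (simp only: char2_power_add[OF char'] u_def monom_power) simp
  then have pow: "[:1, 1::'a:] ^ j = (1 + u) ^ m"
    by (simp only: j power_mult)
  obtain r where r: "(1 + u) ^ m = 1 + of_nat m * u + u ^ 2 * r"
    using power_one_plus_expand by blast
  have "of_nat m = (1 :: 'a poly)"
    using m by (elim oddE) (simp add: mult_2 char2_simps[OF char'])
  with r have "coeff ((1 + u) ^ m) (2 ^ i) = 1"
    by (simp add: u_def monom_power coeff_monom_mult)
  then have "coeff (1 + monom (1::'a) j) (2 ^ i) = 1" using eq pow by simp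
  then have "j = 2 ^ i" by (simp split: if_splits)
  then show ?thesis ..
qed

text \<open>On the line (1, V, 0) vanishing would force (1 + V)^j = 1 + V^j. The lemma lets a
  vanishing component of \<open>Phi f\<close> be read as a vanishing coefficient of f.\<close>

lemma phi_pow_neq_0:
  assumes char: "CHAR('a::idom) = 2" and j: "j > 0" "\<nexists>i. j = 2 ^ i"
  shows "phi_pow j var_x var_y (var_z :: 'a poly poly poly) \<noteq> 0"
proof
  have char': "CHAR('a poly) = 2" using char by simp
  assume "phi_pow j var_x var_y (var_z :: 'a poly poly poly) = 0"
  then have "1 + [:0, 1:] ^ j + [:1, 1::'a:] ^ j = 0"
    using line_phi_pow[OF char, of j] j(1) by (simp add: line.hom_0 zero_power)
  then have "[:1, 1::'a:] ^ j = 1 + monom 1 j"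
    by (metis add_eq_0_iff2 uminus_CHAR_2 char' monom_altdef smult_1_left add.commute)
  then show False
    using char2_binomial_eq_imp_power_of_2[OF char j(1)] j(2) by blast
qed

lemma line_power_2:
  assumes "CHAR('a::comm_ring_1) = 2"
  shows "[:1, 1::'a:] ^ (2 ^ i) = 1 + [:0, 1:] ^ (2 ^ i)"
proof -
  have "[:1, 1::'a:] = 1 + [:0, 1:]" by (simp add: one_pCons)
  then show ?thesis using assms by (simp only: char2_power_add semiring_char_poly) simp
qed

text \<open>Multiplied by V (1 + V), the two restrictions become V + V^(2^k) and V^2 + V^(2^(k-1)).
  As k is at least 3, the higher terms do not reach V or V^2, where coefficients are
  compared.\<close>

lemma coeff_line_gold:
  assumes char: "CHAR('a::comm_ring_1) = 2" and "k \<ge> 3"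
  defines "p \<equiv> line (phi_pow (2 ^ k + 1) var_x var_y (var_z :: 'a poly poly poly))"
    and "q \<equiv> line (phi_pow (2 ^ (k - 1) + 2) var_x var_y (var_z :: 'a poly poly poly))"
  shows "coeff p 0 = 1" "coeff p 1 = 1" "coeff q 0 = 0" "coeff q 1 = 1"
proof -
  have char': "CHAR('a poly) = 2" using char by simp
  have "(2::nat) ^ 2 \<le> 2 ^ (k - 1)" "(2::nat) ^ 2 \<le> 2 ^ k"
    using \<open>k \<ge> 3\<close> by (intro power_increasing; simp)+
  then have big: "(2::nat) < 2 ^ (k - 1)" "(2::nat) < 2 ^ k" by simp_all
  have c: "coeff ([:0, 1:] ^ n) i = (if i = n then 1 else 0 :: 'a)" for n i
    using coeff_monom[of "1::'a" n i] by (simp add: monom_altdef)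
  have "[:0, 1:] * ([:1, 1:] * p) = [:0, 1:] + [:0, 1:] ^ (2 ^ k)"
    unfolding p_def line_phi_pow[OF char]
    by (simp add: line_power_2[OF char] power_add algebra_simps one_pCons char2_simps[OF char']
        char2_two[OF char])
  then have "coeff ([:0, 1:] * ([:1, 1:] * p)) n = coeff ([:0, 1:] + [:0, 1:] ^ (2 ^ k)) n" for n
    by simp
  from this[of 1] this[of 2] show p: "coeff p 0 = 1" "coeff p 1 = 1"
    using big by (simp_all add: c coeff_pCons numeral_2_eq_2 add_eq_0_iff2 uminus_CHAR_2[OF char])
  have "[:0, 1:] * ([:1, 1:] * q) = [:0, 1:] ^ 2 + [:0, 1:] ^ (2 ^ (k - 1))"
    unfolding q_def line_phi_pow[OF char]
    by (simp add: line_power_2[OF char] power_add algebra_simps one_pCons char2_simps[OF char']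
        char2_two[OF char] power2_eq_square)
  then have "coeff ([:0, 1:] * ([:1, 1:] * q)) n = coeff ([:0, 1:] ^ 2 + [:0, 1:] ^ (2 ^ (k - 1))) n" for n
    by simp
  from this[of 1] this[of 2] show "coeff q 0 = 0" "coeff q 1 = 1"
    using big by (simp_all add: c coeff_pCons numeral_2_eq_2 add_eq_0_iff2 uminus_CHAR_2[OF char])
qed

subsection \<open>Factorizations over an algebraically closed field\<close>

text \<open>Here e = 2^(k-1) - 1, so the exponents 2e + 3 and e + 3 of f give forms of degree 2e and
  e. The coefficients of f below e + 3 are arbitrary.\<close>

locale gold_perturbation =
  fixes f :: "'k::alg_closed_field poly" and k e :: nat and a :: 'k
  assumes char: "CHAR('k) = 2" and k: "k \<ge> 3" "odd k"
    and e: "2 ^ (k - 1) = e + 1" "2 ^ k = 2 * e + 2" "e \<ge> 1"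
    and deg: "degree f = 2 * e + 3" and top: "coeff f (2 * e + 3) = 1"
    and gap: "\<And>j. e + 3 < j \<Longrightarrow> j < 2 * e + 3 \<Longrightarrow> coeff f j = 0"
    and second: "coeff f (e + 3) = a" and a_nz: "a \<noteq> 0"
begin

abbreviation gold :: "'k poly poly poly" where
  "gold \<equiv> phi_pow (2 * e + 3) var_x var_y var_z"

abbreviation next_gold :: "'k poly poly poly" where
  "next_gold \<equiv> phi_pow (e + 3) var_x var_y var_z"

text \<open>The zeros in z of \<open>gold\<close>. The values b = 0 and b = 1 belong to the lines x
  + z and x + y, which lie in the denominator.\<close>

definition roots :: "'k poly poly set" where
  "roots = gold_root ` ({b. b ^ (2 ^ k) = b} - {0, 1})"

lemma exponents: "2 ^ k + 1 = 2 * e + 3" "2 ^ (k - 1) + 2 = e + 3"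
  using e by simp_all

lemma finite_roots: "finite roots" and card_roots: "card roots = 2 * e"
proof -
  let ?S = "{b :: 'k. b ^ (2 ^ k) = b}"
  have c: "card ?S = 2 ^ k" using card_frobenius_fixed[OF char] k by simp
  then have fin: "finite ?S" using card.infinite by force
  then show "finite roots" by (simp add: roots_def)
  have "card roots = card (?S - {0, 1})"
    unfolding roots_def by (intro card_image inj_on_subset[OF gold_root_inj[OF char]]) simp
  also have "\<dots> = 2 ^ k - 2"
    using fin c by (subst card_Diff_subset) simp_all
  finally show "card roots = 2 * e" using e by simp
qed

lemma roots_gold: "r \<in> roots \<Longrightarrow> poly gold r = 0"
  using poly_gold_root_eq_0[OF char, of _ k, unfolded exponents] by (auto simp: roots_def)

lemma roots_next_gold: "r \<in> roots \<Longrightarrow> poly next_gold r \<noteq> 0"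
  using poly_gold_root_neq_0[OF char k(2), unfolded exponents] by (auto simp: roots_def)

lemma coeff_line:
  "coeff (line gold) 0 = 1" "coeff (line gold) 1 = 1"
  "coeff (line next_gold) 0 = 0" "coeff (line next_gold) 1 = 1"
  using coeff_line_gold[OF char k(1)] by (simp_all only: exponents)

lemma gold_nz: "gold \<noteq> 0"
  using coeff_line(1) line.hom_0 by (metis coeff_0 zero_neq_one)

lemma coeff_homog_f:
  "coeff (homog (Phi f)) (2 * e) = gold"
  "coeff (homog (Phi f)) e = const3 a * next_gold"
  "e < m \<Longrightarrow> m < 2 * e \<Longrightarrow> coeff (homog (Phi f)) m = 0"
  using gap[of "m + 3"]
  by (simp_all add: coeff_homog_Phi top second const3.hom_1 const3.hom_0 del: phi_pow.simps)

lemma degree_homog_f: "degree (homog (Phi f)) = 2 * e"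
proof (rule antisym)
  show "degree (homog (Phi f)) \<le> 2 * e"
    by (rule degree_le) (simp add: coeff_homog_Phi coeff_eq_0 deg const3.hom_0 del: phi_pow.simps)
  show "2 * e \<le> degree (homog (Phi f))"
    by (rule le_degree) (simp only: coeff_homog_f gold_nz not_False_eq_True)
qed

lemma Phi_f_nz: "Phi f \<noteq> 0"
  using degree_homog_f e(3) by (auto simp: homog.hom_0)

lemma Phi_f_not_unit: "\<not> Phi f dvd 1"
  using is_unit_iff_degree_homog[OF Phi_f_nz] degree_homog_f e(3) by simp

section \<open>Top-down comparison of components in a nontrivial factorization\<close>

context
  fixes P Q :: "'k poly poly poly"
  assumes PQ: "Phi f = P * Q" and nP: "\<not> P dvd 1" and nQ: "\<not> Q dvd 1"
begin

abbreviation (input) "hP \<equiv> homog P"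
abbreviation (input) "hQ \<equiv> homog Q"

lemma nz: "P \<noteq> 0" "Q \<noteq> 0"
  using PQ Phi_f_nz by auto

lemma degree_pos: "degree hP > 0" "degree hQ > 0"
  using nz nP nQ is_unit_iff_degree_homog by blast+

lemma hPQ: "hP * hQ = homog (Phi f)"
  by (simp add: PQ homog.hom_mult)

lemma degree_sum: "degree hP + degree hQ = 2 * e"
  using degree_mult_eq[of hP hQ] nz by (simp add: hPQ degree_homog_f)

lemma lead_mult: "lead_coeff hP * lead_coeff hQ = gold"
  by (simp only: lead_coeff_mult[symmetric] hPQ degree_homog_f coeff_homog_f)

text \<open>\<open>reflect_poly\<close> indexes components by their distance from the top degree, so
  the convolution does not involve the unknown degrees of P and Q.\<close>

lemma reflect_mult:
  assumes "n \<le> 2 * e"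
  shows "(\<Sum>i\<le>n. coeff (reflect_poly hP) i * coeff (reflect_poly hQ) (n - i))
     = coeff (homog (Phi f)) (2 * e - n)"
proof -
  have "coeff (reflect_poly hP * reflect_poly hQ) n = coeff (reflect_poly (homog (Phi f))) n"
    by (simp only: reflect_poly_mult[symmetric] hPQ)
  then show ?thesis
    using assms by (simp only: coeff_mult coeff_reflect_poly[of "homog (Phi f)"] degree_homog_f) simp
qed

lemma degree_reflect: "degree (coeff (reflect_poly hP) n) \<le> degree hP - n"
  "degree (coeff (reflect_poly hQ) n) \<le> degree hQ - n"
  by (simp_all add: coeff_reflect_poly degree_coeff_homog)

lemma roots_product: "\<forall>r\<in>roots. poly (lead_coeff hP * lead_coeff hQ) r = 0"
  using roots_gold by (simp only: lead_mult) blast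

lemma lead_nz: "lead_coeff hP \<noteq> 0" "lead_coeff hQ \<noteq> 0"
  using nz by simp_all

text \<open>Premises of \<open>roots_split\<close> for the two top forms: their total degrees add up
  to the number of roots and bound their degrees in z.\<close>

lemmas split = finite_roots card_roots[folded degree_sum] roots_product lead_nz
  degree_coeff_homog degree_coeff_homog

text \<open>Since the top components share no root and their degrees add up to the number of roots,
  an equation between cross products in degrees strictly below the top forces both lower
  components to vanish.\<close>

lemma cross_eq_0:
  assumes "lead_coeff hP * coeff (reflect_poly hQ) n + coeff (reflect_poly hP) n * lead_coeff hQ = 0"
    and "n > 0"
  shows "coeff (reflect_poly hP) n = 0" "coeff (reflect_poly hQ) n = 0"
proof -
  have "degree (coeff (reflect_poly hQ) n) < degree hQ"
    using degree_reflect(2)[of n] degree_pos \<open>n > 0\<close> by linarith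
  with assms(1) show *: "coeff (reflect_poly hQ) n = 0"
    by (rule roots_split_mult_eq_0[OF split])
  with assms(1) show "coeff (reflect_poly hP) n = 0"
    using lead_nz by simp
qed

text \<open>\<open>Phi f\<close> has no component at these distances from the top. By induction only
  the two products containing a top form survive, and \<open>cross_eq_0\<close> applies.\<close>

lemma middle_eq_0:
  "0 < n \<Longrightarrow> n < e \<Longrightarrow> coeff (reflect_poly hP) n = 0 \<and> coeff (reflect_poly hQ) n = 0"
proof (induction n rule: less_induct)
  case (less n)
  let ?t = "\<lambda>i. coeff (reflect_poly hP) i * coeff (reflect_poly hQ) (n - i)"
  have "?t i = 0" if "0 < i" "i < n" for i
    using less that by simp
  then have "(\<Sum>i\<le>n. ?t i) = (\<Sum>i\<in>{0, n}. ?t i)"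
    by (intro sum.mono_neutral_right) auto
  moreover have "(\<Sum>i\<le>n. ?t i) = 0"
    using less.prems by (subst reflect_mult) (simp_all add: coeff_homog_f)
  ultimately show ?case
    using less.prems by (intro conjI cross_eq_0) simp_all
qed

lemma cross_eq:
  "lead_coeff hP * coeff (reflect_poly hQ) e + coeff (reflect_poly hP) e * lead_coeff hQ
     = const3 a * next_gold"
proof -
  let ?t = "\<lambda>i. coeff (reflect_poly hP) i * coeff (reflect_poly hQ) (e - i)"
  have "?t i = 0" if "0 < i" "i < e" for i
    using middle_eq_0 that by simp
  then have "(\<Sum>i\<le>e. ?t i) = (\<Sum>i\<in>{0, e}. ?t i)"
    by (intro sum.mono_neutral_right) auto
  moreover have "(\<Sum>i\<le>e. ?t i) = const3 a * next_gold"
    by (subst reflect_mult) (simp_all add: coeff_homog_f del: phi_pow.simps)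
  ultimately show ?thesis
    using e(3) by simp
qed

text \<open>Otherwise Q has no component at distance e, and its top form divides
  \<open>const3 a * next_gold\<close>. But that top form vanishes at some element of
  \<open>roots\<close>, where \<open>next_gold\<close> does not.\<close>

lemma degree_ge: "e \<le> degree hQ"
proof (rule ccontr)
  assume "\<not> e \<le> degree hQ"
  then have "coeff (reflect_poly hQ) e = 0"
    by (simp add: coeff_reflect_poly)
  then have eq: "coeff (reflect_poly hP) e * lead_coeff hQ = const3 a * next_gold"
    using cross_eq by simp
  have "{r \<in> roots. poly (lead_coeff hQ) r = 0} \<noteq> {}"
    using roots_split(1)[OF split] degree_pos by (metis card.empty less_irrefl)
  then obtain r where r: "r \<in> roots" "poly (lead_coeff hQ) r = 0" by blast
  then have "poly (const3 a * next_gold) r = 0"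
    using arg_cong[OF eq, of "\<lambda>p. poly p r"] by simp
  then show False
    using roots_next_gold[OF r(1)] a_nz by (simp add: const3_def)
qed

end

text \<open>By \<open>degree_ge\<close> in both orders of the factors, both degrees are at least e,
  and their sum is 2e.\<close>

lemma degree_factors:
  assumes "Phi f = P * Q" "\<not> P dvd 1" "\<not> Q dvd 1"
  shows "degree (homog P) = e" "degree (homog Q) = e"
  using degree_ge[OF assms] degree_ge[of Q P] assms degree_sum[OF assms]
  by (simp_all add: mult.commute)

text \<open>In a product P1 P2 Q of three non-units, P1 and P1 P2 would both have total degree e by
  \<open>degree_factors\<close>, leaving degree 0 for P2.\<close>

lemma irreducible_factor:
  assumes PQ: "Phi f = P * Q" and "\<not> P dvd 1" and "\<not> Q dvd 1"
  shows "irreducible P"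
proof (rule irreducibleI)
  have "Phi f \<noteq> 0" by (rule Phi_f_nz)
  then show "P \<noteq> 0" using PQ by auto
  show "\<not> P dvd 1" by fact
  fix P1 P2 assume P: "P = P1 * P2"
  show "P1 dvd 1 \<or> P2 dvd 1"
  proof (rule ccontr)
    assume n: "\<not> (P1 dvd 1 \<or> P2 dvd 1)"
    then have "\<not> P2 * Q dvd 1" by (auto dest: dvd_mult_left)
    then have "degree (homog P1) = e"
      using degree_factors(1)[of P1 "P2 * Q"] n PQ P by (simp add: mult.assoc)
    moreover have "degree (homog (P1 * P2)) = e"
      using degree_factors(1)[OF assms] P by simp
    moreover have "P1 \<noteq> 0" "P2 \<noteq> 0" using P \<open>P \<noteq> 0\<close> by auto
    ultimately have "degree (homog P2) = 0"
      by (simp add: homog.hom_mult degree_mult_eq)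
    then show False
      using is_unit_iff_degree_homog[OF \<open>P2 \<noteq> 0\<close>] n by blast
  qed
qed

text \<open>The total degree is e and the distances 1 to e - 1 are empty, so only the top form and a
  scalar remain; the scalar sits at distance e.\<close>

lemma homog_factor:
  assumes "Phi f = P * Q" "\<not> P dvd 1" "\<not> Q dvd 1"
  shows "\<exists>c. homog P = monom (lead_coeff (homog P)) e + [:const3 c:]
    \<and> coeff (reflect_poly (homog P)) e = const3 c"
proof -
  obtain c where c: "coeff (homog P) 0 = const3 c" using coeff_homog_0_const by blast
  have d: "degree (homog P) = e" by (rule degree_factors[OF assms])
  have "coeff (homog P) m = coeff (monom (lead_coeff (homog P)) e + [:const3 c:]) m" for m
  proof -
    consider "m = 0" | "0 < m" "m < e" | "m = e" | "m > e" by linarith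
    then show ?thesis
    proof cases
      case 2
      then have "coeff (reflect_poly (homog P)) (e - m) = 0"
        using middle_eq_0[OF assms, of "e - m"] by simp
      then have "coeff (homog P) m = 0" using 2 by (simp add: coeff_reflect_poly d split: if_splits)
      then show ?thesis using 2 by (cases m) simp_all
    qed (use c d e(3) in \<open>auto simp: coeff_eq_0 coeff_pCons split: nat.splits\<close>)
  qed
  then have "homog P = monom (lead_coeff (homog P)) e + [:const3 c:]" by (rule poly_eqI)
  moreover have "coeff (reflect_poly (homog P)) e = const3 c"
    by (simp add: coeff_reflect_poly d c)
  ultimately show ?thesis by blast
qed

text \<open>Each factor is a top form plus a scalar, c for P and d for Q. Restricting the product of
  the top forms and the identity \<open>cross_eq\<close> to the line (1, V, 0) determines c and d up
  to the scaling u.\<close>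

lemma factor_normal_form:
  assumes PQ: "Phi f = P * Q" and nP: "\<not> P dvd 1" and nQ: "\<not> Q dvd 1"
  obtains A B u where "u \<noteq> 0" "P = const3 u * (A + const3 a)" "Q = const3 (inverse u) * (B + const3 a)"
    "A + B = next_gold" "A * B = gold" "degree A \<le> e" "degree B \<le> e"
    "homog (Phi f) = monom gold (2 * e) + monom (const3 a * next_gold) e + [:const3 (a\<^sup>2):]"
proof -
  note asm = PQ nP nQ
  have asm': "Phi f = Q * P" "\<not> Q dvd 1" "\<not> P dvd 1" using asm by (simp_all add: mult.commute)
  define A0 B0 where "A0 = lead_coeff (homog P)" and "B0 = lead_coeff (homog Q)"
  obtain c where c: "homog P = monom A0 e + [:const3 c:]" "coeff (reflect_poly (homog P)) e = const3 c"
    using homog_factor[OF asm] unfolding A0_def by blast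
  obtain d where d: "homog Q = monom B0 e + [:const3 d:]" "coeff (reflect_poly (homog Q)) e = const3 d"
    using homog_factor[OF asm'] unfolding B0_def by blast
  have P: "P = A0 + const3 c" and Q: "Q = B0 + const3 d"
    using arg_cong[OF c(1), of "\<lambda>p. poly p 1"] arg_cong[OF d(1), of "\<lambda>p. poly p 1"]
    by (simp_all add: poly_monom)
  have prod: "A0 * B0 = gold"
    unfolding A0_def B0_def by (rule lead_mult[OF asm])
  have cross: "A0 * const3 d + const3 c * B0 = const3 a * next_gold"
    using cross_eq[OF asm, folded A0_def B0_def] by (simp only: c(2) d(2))
  define p q where "p = line A0" and "q = line B0"
  have pq: "p * q = line gold"
    using arg_cong[OF prod, of line] by (simp only: line.hom_mult p_def q_def)
  have "p * [:d:] + [:c:] * q = [:a:] * line next_gold"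
    using arg_cong[OF cross, of line]
    by (simp only: line.hom_mult line.hom_add line_const3 p_def q_def)
  then have "smult d p + smult c q = smult a (line next_gold)"
    by (simp del: phi_pow.simps)
  from arg_cong[OF this, of "\<lambda>w. coeff w i" for i]
  have lin: "d * coeff p i + c * coeff q i = a * coeff (line next_gold) i" for i
    by (simp only: coeff_add coeff_smult)
  \<comment> \<open>Coefficients of 1 and V in p q = \<open>line gold\<close> and in d p + c q = a
    \<open>line next_gold\<close>.\<close>
  have eqs: "coeff p 0 * coeff q 0 = 1" "d * coeff p 0 + c * coeff q 0 = 0"
      "coeff p 0 * coeff q 1 + coeff p 1 * coeff q 0 = 1" "d * coeff p 1 + c * coeff q 1 = a"
    using lin[of 0] lin[of 1] arg_cong[OF pq, of "\<lambda>p. coeff p 0"]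
      arg_cong[OF pq, of "\<lambda>p. coeff p 1"]
    by (simp_all only: coeff_line coeff_mult) simp_all
  \<comment> \<open>The constant coefficient of p is the right scale: dividing P and multiplying Q
    by it makes both scalars equal to a.\<close>
  define u where "u = coeff p 0"
  have "u \<noteq> 0" using eqs(1) by (auto simp: u_def)
  have q0: "coeff q 0 = inverse u"
    using inverse_unique[OF eqs(1)] by (simp add: u_def)
  have "c * inverse u = d * u"
    using eqs(2) by (simp add: q0 u_def[symmetric] add_eq_0_iff2 uminus_CHAR_2[OF char])
  then have cd: "c = u * u * d"
    using \<open>u \<noteq> 0\<close> by (simp add: field_simps)
  \<comment> \<open>The bracket is 1 by the third equation and the right side is a by the
    fourth.\<close>
  have "u * d * (u * coeff q 1 + coeff p 1 * inverse u) = d * coeff p 1 + c * coeff q 1"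
    using \<open>u \<noteq> 0\<close> by (simp add: cd field_simps)
  then have ud: "u * d = a"
    using eqs(3) by (simp only: eqs(4) q0[symmetric] u_def[symmetric] mult_1_right)
  then have c': "c = u * a" and d': "d = inverse u * a"
    using cd \<open>u \<noteq> 0\<close> by (auto simp: field_simps)
  have inv: "const3 u * const3 (inverse u) = 1"
    using \<open>u \<noteq> 0\<close> by (simp flip: const3.hom_mult add: const3.hom_1)
  define A B where "A = const3 (inverse u) * A0" and "B = const3 u * B0"
  have "const3 u * A = (const3 u * const3 (inverse u)) * A0"
    "const3 (inverse u) * B = (const3 u * const3 (inverse u)) * B0"
    by (simp_all only: A_def B_def mult_ac)
  then have A0: "A0 = const3 u * A" and B0: "B0 = const3 (inverse u) * B"
    by (simp_all only: inv mult_1)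
  show ?thesis
  proof
    show "u \<noteq> 0" by fact
    show "P = const3 u * (A + const3 a)" "Q = const3 (inverse u) * (B + const3 a)"
      by (simp_all add: P Q A0 B0 c' d' distrib_left const3.hom_mult)
    have "A * B = (const3 u * const3 (inverse u)) * (A0 * B0)"
      by (simp only: A_def B_def mult_ac)
    then show "A * B = gold" by (simp only: inv prod mult_1)
    have "const3 a * (A + B) = A0 * const3 d + const3 c * B0"
      by (simp add: A_def B_def c' d' const3.hom_mult algebra_simps)
    then have "const3 a * (A + B) = const3 a * next_gold" by (simp only: cross)
    moreover have "const3 a \<noteq> 0" using a_nz by (simp add: const3_def)
    ultimately show "A + B = next_gold" by (simp only: mult_cancel_left simp_thms)
    have "degree A0 \<le> e" "degree B0 \<le> e"
      using degree_coeff_homog[of P e] degree_coeff_homog[of Q e] degree_factors[OF asm]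
      by (simp_all add: A0_def B0_def)
    then show "degree A \<le> e" "degree B \<le> e"
      by (simp_all add: A_def B_def const3_def order.trans[OF degree_smult_le])
    have "homog (Phi f) = (monom A0 e + [:const3 c:]) * (monom B0 e + [:const3 d:])"
      by (simp only: PQ homog.hom_mult c d)
    also have "\<dots> = monom A0 e * monom B0 e + (monom A0 e * [:const3 d:] + [:const3 c:] * monom B0 e)
        + [:const3 c:] * [:const3 d:]"
      by (simp only: distrib_left distrib_right add_ac)
    also have "\<dots> = monom (A0 * B0) (e + e) + monom (A0 * const3 d + const3 c * B0) e + [:const3 c * const3 d:]"
      by (simp add: mult_monom smult_monom add_monom mult.commute[of A0])
    also have "const3 c * const3 d = const3 (a\<^sup>2)"
      using \<open>u \<noteq> 0\<close> by (simp add: c' d' power2_eq_square field_simps flip: const3.hom_mult)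
    finally show "homog (Phi f) = monom gold (2 * e) + monom (const3 a * next_gold) e + [:const3 (a\<^sup>2):]"
      by (simp only: prod cross mult_2)
  qed
qed

text \<open>In the normal form the component of degree 0 is a^2 and those strictly between 0 and e
  vanish. Exponent j of f corresponds to degree j - 3, and \<open>phi_pow_neq_0\<close> cancels
  \<open>phi_pow j\<close>.\<close>

lemma coeff_f_of_factor:
  assumes "Phi f = P * Q" "\<not> P dvd 1" "\<not> Q dvd 1"
  shows "coeff f 3 = a\<^sup>2" "3 < j \<Longrightarrow> j < e + 3 \<Longrightarrow> \<nexists>i. j = 2 ^ i \<Longrightarrow> coeff f j = 0"
proof -
  have eq: "homog (Phi f) = monom gold (2 * e) + monom (const3 a * next_gold) e + [:const3 (a\<^sup>2):]"
    using factor_normal_form[OF assms] by blast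
  have "const3 (coeff f 3) = const3 (a\<^sup>2)"
    using arg_cong[OF eq, of "\<lambda>p. coeff p 0"] coeff_homog_Phi[of f 0] e(3)
    by (simp add: numeral_3_eq_3)
  then show "coeff f 3 = a\<^sup>2" by (simp add: const3_def)
  assume j: "3 < j" "j < e + 3" "\<nexists>i. j = 2 ^ i"
  then have "coeff (homog (Phi f)) (j - 3) = 0"
    unfolding eq by (auto simp: coeff_pCons split: nat.splits)
  then have "const3 (coeff f j) * phi_pow j var_x var_y var_z = 0"
    using j coeff_homog_Phi[of f "j - 3"] by simp
  moreover have "phi_pow j var_x var_y (var_z :: 'k poly poly poly) \<noteq> 0"
    using j by (intro phi_pow_neq_0[OF char]) simp_all
  ultimately show "coeff f j = 0" by (simp add: const3_def)
qed

section \<open>Frobenius acting on the two factors of the top form\<close>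

lemma frobenius_hom: "comm_ring_hom (\<lambda>c :: 'k. c\<^sup>2)"
  using char2_power_add[OF char, of _ _ 1] by unfold_locales (simp_all add: power_mult_distrib)

text \<open>A and B are the roots of a quadratic equation with coefficients in the prime field, so the
  Frobenius map fixes or swaps them. It sends the root belonging to b to the one belonging to b^2,
  and its k-th power fixes all roots, which rules out a swap because k is odd.\<close>

lemma frobenius_fixes_factor:
  assumes sum: "A + B = next_gold" and prod: "A * B = gold"
    and dA: "degree A \<le> e" and dB: "degree B \<le> e"
  shows "map_poly3 (\<lambda>c. c\<^sup>2) A = A"
proof -
  let ?s = "map_poly3 (\<lambda>c :: 'k. c\<^sup>2)" and ?s2 = "map_poly (map_poly (\<lambda>c :: 'k. c\<^sup>2))"
  interpret s: comm_ring_hom ?s by (rule map_poly3_hom[OF frobenius_hom])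
  interpret s2: comm_ring_hom ?s2
    by (intro comm_ring_hom.map_poly_hom frobenius_hom)
  have s_phi: "?s (phi_pow j var_x var_y var_z) = phi_pow j var_x var_y var_z" for j
    by (simp add: phi_pow_hom[OF s.comm_ring_hom_axioms] map_poly3_simps[OF frobenius_hom])
  have "?s (A + B) = A + B" "?s (A * B) = A * B"
    unfolding sum prod by (rule s_phi)+
  then have s_sum: "?s A + ?s B = A + B" and s_prod: "?s A * ?s B = A * B"
    by (simp_all only: s.hom_add s.hom_mult)
  \<comment> \<open>The image of A is a zero of (T - A)(T - B), since Frobenius preserves the sum
    and the product.\<close>
  have "(?s A - A) * (?s A - B) = ?s A * ?s A - ?s A * (A + B) + A * B"
    by (simp add: algebra_simps)
  also have "\<dots> = 0" by (simp add: s_sum[symmetric] s_prod[symmetric] algebra_simps)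
  finally have "?s A = A \<or> ?s A = B" by simp
  moreover have False if swap: "?s A = B"
  proof -
    have swap': "?s B = A" using s_sum swap by (simp add: add.commute)
    have nz: "A \<noteq> 0" "B \<noteq> 0" using prod gold_nz by auto
    have rts: "\<forall>r\<in>roots. poly (A * B) r = 0" using roots_gold by (simp only: prod) blast
    have card: "card roots = e + e" using card_roots by simp
    note excl = roots_split(2)[OF finite_roots card rts nz dA dB]
    have s2_root: "?s2 (gold_root b) = gold_root (b\<^sup>2)" for b :: 'k
      using char2_power_add[OF char, of _ _ 1]
      by (simp add: gold_root_def map_poly_pCons power_mult_distrib power_inverse)
    have "poly (?s C) (?s2 r) = ?s2 (poly C r)" for C r
      by (simp add: map_poly3_def s2.hom_poly)
    then have step: "poly C (gold_root b) = 0 \<Longrightarrow> poly (?s C) (gold_root (b\<^sup>2)) = 0" for C b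
      by (metis s2_root s2.hom_0)
    have iter: "poly A (gold_root b) = 0 \<Longrightarrow> poly (if even i then A else B) (gold_root (b ^ (2 ^ i))) = 0"
      "poly B (gold_root b) = 0 \<Longrightarrow> poly (if even i then B else A) (gold_root (b ^ (2 ^ i))) = 0" for b i
    proof (induction i)
      case (Suc i)
      have eq: "b ^ (2 ^ Suc i) = (b ^ (2 ^ i))\<^sup>2" by (simp add: power_mult[symmetric] mult.commute)
      { case 1
        then show ?case using Suc(1) step[of A "b ^ (2 ^ i)"] step[of B "b ^ (2 ^ i)"] swap swap'
          unfolding eq by (auto split: if_splits) }
      { case 2
        then show ?case using Suc(2) step[of A "b ^ (2 ^ i)"] step[of B "b ^ (2 ^ i)"] swap swap'
          unfolding eq by (auto split: if_splits) }
    qed simp_all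
    have "roots \<noteq> {}" using card_roots e(3) by auto
    then obtain b where b: "b ^ (2 ^ k) = b" "gold_root b \<in> roots" by (auto simp: roots_def)
    show False
      using excl[OF b(2)] iter[of b k] k(2) b(1) by auto
  qed
  ultimately show ?thesis by blast
qed

end

subsection \<open>Descent to the finite field\<close>

lemma to_ac_hom: "comm_ring_hom to_ac"
  by standard simp_all

text \<open>Translation by 1 permutes the field, so comparing the sums of all elements shows that
  its cardinality is 0 in the field; as this is 2^n, also 2 = 0.\<close>

lemma CHAR_eq_2_of_CARD:
  assumes "CARD('a::{finite, field}) = 2 ^ n"
  shows "CHAR('a) = 2"
proof -
  have "(\<Sum>x\<in>(UNIV :: 'a set). x + 1) = (\<Sum>x\<in>UNIV. x)"
    by (rule sum.reindex_bij_witness[of _ "\<lambda>x. x - 1" "\<lambda>x. x + 1"]) auto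
  then have "of_nat (CARD('a)) = (0 :: 'a)"
    by (simp add: sum.distrib)
  then have "(2 :: 'a) = 0"
    using assms by simp
  then have "CHAR('a) dvd 2"
    using of_nat_eq_0_iff_char_dvd[of 2, where 'a = 'a] by simp
  then show ?thesis
    using prime_nat_iff two_is_prime_nat CHAR_not_1 by (metis One_nat_def)
qed

text \<open>A coefficient fixed by squaring is 0 or 1 and so already lies in the base field.\<close>

lemma map_poly3_to_ac_of_ac:
  fixes A :: "'a::field alg_closure poly poly poly"
  assumes "map_poly3 (\<lambda>c. c\<^sup>2) A = A"
  shows "map_poly3 to_ac (map_poly3 of_ac A) = A"
proof (rule poly3_eqI)
  fix i j l
  let ?c = "coeff (coeff (coeff A i) j) l"
  have "?c\<^sup>2 = ?c"
    using arg_cong[OF assms, of "\<lambda>p. coeff (coeff (coeff p i) j) l"]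
    by (simp add: coeff_map_poly3)
  then have "?c * (?c - 1) = 0" by (simp add: power2_eq_square algebra_simps)
  then have "?c = 0 \<or> ?c = 1" by auto
  then show "coeff (coeff (coeff (map_poly3 to_ac (map_poly3 of_ac A)) i) j) l = ?c"
    by (auto simp: coeff_map_poly3)
qed

lemma map_poly3_to_ac_inj:
  assumes "map_poly3 to_ac P = map_poly3 to_ac (Q :: 'a::field poly poly poly)"
  shows "P = Q"
proof (rule poly3_eqI)
  fix i j l
  show "coeff (coeff (coeff P i) j) l = coeff (coeff (coeff Q i) j) l"
    using arg_cong[OF assms, of "\<lambda>p. coeff (coeff (coeff p i) j) l"]
    by (simp add: coeff_map_poly3)
qed

lemma abs_irreducible_iff: "abs_irreducible p \<longleftrightarrow> irreducible (map_poly3 to_ac p)"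
  by (simp add: abs_irreducible_def map_poly3_def)

text \<open>A factorization exists over the algebraic closure. Without the scalar u its factors are
  A + a and B + a, where A and B are fixed by Frobenius and a lies in the base field, so they
  descend.\<close>

lemma abs_irreducible_phi_or_splits:
  fixes f :: "'a::field poly"
  assumes char: "CHAR('a) = 2" and k: "k \<ge> 3" "odd k"
    and deg: "degree f = 2 ^ k + 1" and top: "coeff f (2 ^ k + 1) = 1"
    and gap: "\<And>j. 2 ^ (k - 1) + 2 < j \<Longrightarrow> j < 2 ^ k + 1 \<Longrightarrow> coeff f j = 0"
    and second: "coeff f (2 ^ (k - 1) + 2) = a" "a \<noteq> 0"
    and red: "\<not> abs_irreducible (phi f)"
  shows "coeff f 3 = a\<^sup>2"
    and "3 < j \<Longrightarrow> j < 2 ^ (k - 1) + 2 \<Longrightarrow> \<nexists>i. j = 2 ^ i \<Longrightarrow> coeff f j = 0"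
    and "\<exists>p1 p2. phi f = p1 * p2 \<and> abs_irreducible p1 \<and> abs_irreducible p2"
proof -
  define e :: nat where "e = 2 ^ (k - 1) - 1"
  have "(2::nat) ^ 1 \<le> 2 ^ (k - 1)" using k(1) by (intro power_increasing) simp_all
  then have e1: "2 ^ (k - 1) = e + 1" "e \<ge> 1" by (simp_all add: e_def)
  moreover have "(2::nat) ^ k = 2 * 2 ^ (k - 1)" using k(1) by (cases k) simp_all
  ultimately have e: "2 ^ (k - 1) = e + 1" "2 ^ k = 2 * e + 2" "e \<ge> 1" by simp_all
  have exps: "2 ^ k + 1 = 2 * e + 3" "2 ^ (k - 1) + 2 = e + 3" using e by simp_all
  define F where "F = map_poly to_ac f"
  interpret F: gold_perturbation F k e "to_ac a"
  proof
    show "degree F = 2 * e + 3" using deg by (simp only: F_def exps) (simp add: degree_map_poly)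
    show "coeff F (2 * e + 3) = 1" using top by (simp only: F_def exps) (simp add: coeff_map_poly)
    show "coeff F j = 0" if "e + 3 < j" "j < 2 * e + 3" for j
      using gap[of j] that by (simp only: F_def exps) (simp add: coeff_map_poly)
    show "coeff F (e + 3) = to_ac a" using second by (simp only: F_def exps) (simp add: coeff_map_poly)
  qed (use char k e second in simp_all)
  interpret m: comm_ring_hom "map_poly3 (to_ac :: 'a \<Rightarrow> _)"
    by (rule map_poly3_hom[OF to_ac_hom])
  have PhiF: "map_poly3 to_ac (phi f) = Phi F"
    by (simp add: phi_eq_Phi[OF char] map_poly3_Phi[OF to_ac_hom] F_def)
  have "\<not> irreducible (Phi F)"
    using red by (simp add: abs_irreducible_iff PhiF)
  then obtain P Q where PQ: "Phi F = P * Q" "\<not> P dvd 1" "\<not> Q dvd 1"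
    using irreducibleI[OF F.Phi_f_nz F.Phi_f_not_unit] by blast
  have "to_ac (coeff f 3) = to_ac (a\<^sup>2)"
    using F.coeff_f_of_factor(1)[OF PQ] by (simp add: F_def coeff_map_poly)
  then show "coeff f 3 = a\<^sup>2" by (simp only: to_ac_eq_iff)
  show "coeff f j = 0" if "3 < j" "j < 2 ^ (k - 1) + 2" "\<nexists>i. j = 2 ^ i"
    using F.coeff_f_of_factor(2)[OF PQ, of j] that by (simp only: F_def exps) (simp add: coeff_map_poly)
  obtain A B u where u: "u \<noteq> 0" and P: "P = const3 u * (A + const3 (to_ac a))"
    and Q: "Q = const3 (inverse u) * (B + const3 (to_ac a))"
    and AB: "A + B = F.next_gold" "A * B = F.gold" "degree A \<le> e" "degree B \<le> e"
    using F.factor_normal_form[OF PQ] by blast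
  let ?P = "A + const3 (to_ac a)" and ?Q = "B + const3 (to_ac a)"
  have inv: "const3 u * const3 (inverse u) = 1"
    using u by (simp flip: const3.hom_mult add: const3.hom_1)
  have "Phi F = (const3 u * const3 (inverse u)) * (?P * ?Q)"
    by (simp only: PQ(1) P Q mult_ac)
  then have PQ': "Phi F = ?P * ?Q" by (simp only: inv mult_1)
  have unit: "const3 u dvd 1" "const3 (inverse u) dvd 1"
    using inv by (metis dvd_triv_left, metis dvd_triv_right)
  have n: "\<not> ?P dvd 1" "\<not> ?Q dvd 1"
    using PQ(2,3) unit by (auto simp: P Q mult_unit_dvd_iff)
  have irr: "irreducible ?P" "irreducible ?Q"
    using F.irreducible_factor[OF PQ' n] F.irreducible_factor[of ?Q ?P] PQ' n
    by (simp_all add: mult.commute)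
  define p1 p2 where "p1 = map_poly3 of_ac A + const3 a" and "p2 = map_poly3 of_ac B + const3 a"
  have "map_poly3 (\<lambda>c. c\<^sup>2) A = A" "map_poly3 (\<lambda>c. c\<^sup>2) B = B"
    using AB F.frobenius_fixes_factor[of A B] F.frobenius_fixes_factor[of B A]
    by (simp_all add: add.commute mult.commute)
  then have lift: "map_poly3 to_ac p1 = ?P" "map_poly3 to_ac p2 = ?Q"
    by (simp_all add: p1_def p2_def m.hom_add map_poly3_to_ac_of_ac map_poly3_simps[OF to_ac_hom])
  have "map_poly3 to_ac (phi f) = map_poly3 to_ac (p1 * p2)"
    by (simp only: PhiF PQ' m.hom_mult lift)
  then have "phi f = p1 * p2" by (rule map_poly3_to_ac_inj)
  moreover have "abs_irreducible p1" "abs_irreducible p2"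
    using irr by (simp_all add: abs_irreducible_iff lift)
  ultimately show "\<exists>p1 p2. phi f = p1 * p2 \<and> abs_irreducible p1 \<and> abs_irreducible p2"
    by blast
qed

theorem theorem3p2:
  fixes g :: "'a::{finite, field} poly" and n k :: nat
  assumes card: "CARD('a) = 2 ^ n"
    and k3: "k \<ge> 3" and kodd: "odd k" and cop: "gcd k n = 1"
    and degg: "degree g = 2 ^ (k - 1) + 2"
  defines "f \<equiv> monom 1 (2 ^ k + 1) + g"
  shows "(\<not> (\<exists>a. a \<noteq> 0 \<and> (\<exists>c cs. g - monom a (2 ^ (k - 1) + 2) - monom (a ^ 2) 3
                 = [:c:] + (\<Sum>i<k. monom (cs i) (2 ^ i))))
            \<longrightarrow> abs_irreducible (phi f))
       \<and> ((\<exists>a. a \<noteq> 0 \<and> (\<exists>c cs. g - monom a (2 ^ (k - 1) + 2) - monom (a ^ 2) 3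
                 = [:c:] + (\<Sum>i<k. monom (cs i) (2 ^ i))))
            \<longrightarrow> abs_irreducible (phi f)
                \<or> (\<exists>p1 p2. phi f = p1 * p2 \<and> abs_irreducible p1 \<and> abs_irreducible p2))"
proof (cases "abs_irreducible (phi f)")
  \<comment> \<open>A reducible \<open>phi f\<close> forces the exceptional shape of g, so the
    premise of the first implication fails, and it yields the two factors asked for in the
    second.\<close>
  case False
  let ?m = "2 ^ (k - 1) + 2 :: nat"
  have char: "CHAR('a) = 2" using card by (rule CHAR_eq_2_of_CARD)
  have "(2::nat) ^ 2 \<le> 2 ^ (k - 1)" using k3 by (intro power_increasing) simp_all
  then have k4: "(4::nat) \<le> 2 ^ (k - 1)" by simp
  moreover have k2: "(2::nat) ^ k = 2 * 2 ^ (k - 1)" using k3 by (cases k) simp_all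
  ultimately have m: "3 < ?m" "?m < 2 ^ k + 1" by simp_all
  have coeff_f: "coeff f j = coeff g j" if "j \<noteq> 2 ^ k + 1" for j
    using that by (simp add: f_def)
  have g0: "coeff g j = 0" if "?m < j" for j using that degg by (simp add: coeff_eq_0)
  \<comment> \<open>The only candidate for a is the leading coefficient of g; it is nonzero because
    g has positive degree.\<close>
  define a where "a = coeff g ?m"
  have "a \<noteq> 0" using degg m by (metis a_def leading_coeff_0_iff degree_0 not_less_zero)
  have top: "coeff f (2 ^ k + 1) = 1" using g0 m by (simp add: f_def)
  have deg: "degree f = 2 ^ k + 1"
    unfolding f_def using degg m by (subst degree_add_eq_left) (simp_all add: degree_monom_eq)
  have gap: "coeff f j = 0" if "?m < j" "j < 2 ^ k + 1" for j
    using that coeff_f[of j] g0[of j] by simp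
  have second: "coeff f ?m = a" using coeff_f[of ?m] m by (simp add: a_def)
  note concl = abs_irreducible_phi_or_splits[OF char k3 kodd deg top gap second \<open>a \<noteq> 0\<close> False]
  define cs where "cs i = coeff g (2 ^ i)" for i
  have not_pow2: "2 ^ i \<noteq> (3::nat)" "2 ^ i \<noteq> ?m" for i
  proof -
    show "2 ^ i \<noteq> (3::nat)" by (cases i) (simp_all, presburger)
    \<comment> \<open>The exponent 2^(k-1) + 2 lies strictly between 2^(k-1) and 2^k, as 2^(k-1) is
      at least 4. So the monomials of exponent 2^i never touch it.\<close>
    consider "i \<le> k - 1" | "k \<le> i" using k3 by linarith
    then show "2 ^ i \<noteq> ?m"
    proof cases
      case 1
      then have "(2::nat) ^ i \<le> 2 ^ (k - 1)" by (intro power_increasing) simp_all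
      then show ?thesis by linarith
    next
      case 2
      then have "(2::nat) ^ k \<le> 2 ^ i" by (intro power_increasing) simp_all
      then show ?thesis using k4 k2 by linarith
    qed
  qed
  have sum: "coeff (\<Sum>i<k. monom (cs i) (2 ^ i)) j = (if \<exists>i<k. j = 2 ^ i then coeff g j else 0)" for j
  proof (cases "\<exists>i<k. j = 2 ^ i")
    case True
    then obtain i where i: "i < k" "j = 2 ^ i" by blast
    have "coeff (\<Sum>i<k. monom (cs i) (2 ^ i)) j = (\<Sum>l<k. if l = i then cs i else 0)"
      unfolding coeff_sum by (intro sum.cong) (auto simp: i(2))
    then show ?thesis using True i by (simp add: cs_def)
  qed (auto simp: coeff_sum intro!: sum.neutral)
  have "g - monom a ?m - monom (a ^ 2) 3 = [:coeff g 0:] + (\<Sum>i<k. monom (cs i) (2 ^ i))"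
  proof (rule poly_eqI)
    fix j
    consider (zero) "j = 0" | (three) "j = 3" | (mid) "j = ?m" | (large) "?m < j"
      | (low) "0 < j" "j < ?m" "j \<noteq> 3" by linarith
    then show "coeff (g - monom a ?m - monom (a ^ 2) 3) j
        = coeff ([:coeff g 0:] + (\<Sum>i<k. monom (cs i) (2 ^ i))) j"
    proof cases
      case zero
      then show ?thesis by (simp add: sum)
    next
      case three
      have "coeff g 3 = a\<^sup>2" using concl(1) coeff_f[of 3] m by simp
      then show ?thesis using three m not_pow2(1) by (auto simp: sum coeff_pCons split: nat.splits)
    next
      case mid
      have "\<not> (\<exists>i<k. ?m = 2 ^ i)" using not_pow2(2) by metis
      then have "coeff (\<Sum>i<k. monom (cs i) (2 ^ i)) ?m = 0" by (simp only: sum if_False)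
      then show ?thesis using m unfolding mid by (simp add: a_def)
    next
      case large
      then show ?thesis using g0[of j] m by (auto simp: sum coeff_pCons split: nat.splits)
    next
      case low
      have "coeff g j = 0" if no: "\<nexists>i. j = 2 ^ i"
      proof -
        \<comment> \<open>The exponents 1 and 2 are powers of 2, so here j exceeds 3 and the
          vanishing result applies.\<close>
        have "j \<noteq> 2 ^ 0" "j \<noteq> 2 ^ 1" using no by blast+
        then show ?thesis using concl(2)[of j] coeff_f[of j] low m no by simp
      qed
      moreover have "i < k" if "j = 2 ^ i" for i
      proof (rule ccontr)
        assume "\<not> i < k"
        then have "(2::nat) ^ k \<le> 2 ^ i" by (intro power_increasing) simp_all
        then show False using low m that by linarith
      qed
      ultimately have "coeff (\<Sum>i<k. monom (cs i) (2 ^ i)) j = coeff g j"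
        unfolding sum by auto
      then show ?thesis using low by (simp add: coeff_pCons split: nat.splits)
    qed
  qed
  with \<open>a \<noteq> 0\<close> concl(3) show ?thesis by blast
qed simp

end
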